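(* Consider an $s$-stage DIRK method with invertible lower triangular matrix $A=(a_{kj})_{1\le k,j\le s}$, which is stiffly accurate. Then third order accuracy of its f scheme, together with the condition $G_s=\frac16$, implies third order accuracy of its U scheme. Explicitly, with all coefficients defined from $A$ by the recursions in the context: if $$c_s=1,\quad d_s=\tfrac12,\quad g_s=h_s=\tfrac16,\quad\text{and}\quad G_s=\tfrac16,$$ then $$C_s=1,\quad D_s=\tfrac12,\quad B_s=0,\quad G_s=H_s=\tfrac16,\quad B_s^{*}=B_s^{**}=B_s^{***}=0 .$$
   Context: Stiffly accurate means that the last row of $A$ equals the weight vector, so that the last stage is the update ($f^{n+1}=f^{(s)}$, $U^{n+1}=U^{(s)}$). Set $c_k=\sum_{j=1}^k a_{kj}$. Empty sums are zero. Define, for $1\le j<k\le s$, $$b_{kj} = \frac{a_{kj}}{a_{jj}}-\sum_{l=j+1}^{k-1}\frac{a_{kl}b_{lj}}{a_{ll}}.$$ The f scheme, for $\frac{d}{dt}f=\mathcal{Q}(f)$ (a hyperbolic relaxation or BGK equation $\partial_t f+v\partial_x f=\mathcal{Q}(f)$ written along characteristics), is $f^{(k)}=f^n+\Delta t\sum_{j=1}^{k}a_{kj}\mathcal{Q}(f^{(j)})$, equivalently $f^{(k)}=(1-\sum_{j<k}b_{kj})f^n+\sum_{j<k}b_{kj}f^{(j)}+\Delta t\,a_{kk}\mathcal{Q}(f^{(k)})$. Its Taylor expansion is $$f^{(k)}=f^n+c_k\Delta t\,\mathcal{Q}+d_k\Delta t^2\mathcal{Q}'\mathcal{Q}+\Delta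 t^3\big(g_k\mathcal{Q}''(\mathcal{Q},\mathcal{Q})+h_k\mathcal{Q}'\mathcal{Q}'\mathcal{Q}\big)+O(\Delta t^4)$$ (with $\mathcal{Q}$ and its Fréchet derivatives evaluated at $f^n$), where $$c_k=\sum_{j=1}^{k-1}b_{kj}c_j+a_{kk},\quad d_k=\sum_{j=1}^{k-1}b_{kj}d_j+a_{kk}c_k,\quad g_k=\sum_{j=1}^{k-1}b_{kj}g_j+\tfrac12a_{kk}c_k^2,\quad h_k=\sum_{j=1}^{k-1}b_{kj}h_j+a_{kk}d_k .$$ Comparing with the exact solution, third order accuracy of the f scheme means $c_s=1$, $d_s=\frac12$, $g_s=h_s=\frac16$. The U scheme is the limit of the f scheme in the fluid regime, where the collision operator is infinitely stiff and $f$ is replaced by its local equilibrium $M_U[U]$ with moments $U=\langle f\phi\rangle$; here $\phi(v)$ is the vector of collision invariants, $\langle g\rangle$ is integration over $v$, and $\langle M_U[U]\phi\rangle=U$: $$U^{(k)}(x)=\Big(1-\sum_{j=1}^{k-1}b_{kj}\Big)\langle M_U[U^n](x-c_kv\Delta t,v)\phi(v)\rangle+\sum_{j=1}^{k-1}b_{kj}\langle M_U[U^{(j)}](x-(c_k-c_j)v\Delta t,v)\phi(v)\rangle .$$ It approximates $\partial_tU=\mathcal{T}(U):=-\partial_x\langle vM_U[U]\phi\rangle$. With $\mathcal{B}(U):=\frac12\langle v^2\partial_{xx}(M_U[U])\phi\rangle$ and $\tilde{\mathcal{B}}(U):=-\frac16\langle v^3\partial_{xxx}(M_U[U])\phi\rangle$,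 its Taylor expansion is (all operators evaluated at $U^n$) $$U^{(k)}=U^n+C_k\Delta t\,\mathcal{T}+D_k\Delta t^2\mathcal{T}'\mathcal{T}+B_k\Delta t^2\mathcal{B}+\Delta t^3\big(G_k\mathcal{T}''(\mathcal{T},\mathcal{T})+H_k\mathcal{T}'\mathcal{T}'\mathcal{T}+B_k^{*}\mathcal{T}'\mathcal{B}+B_k^{**}\mathcal{B}'\mathcal{T}+B_k^{***}\tilde{\mathcal{B}}\big)+O(\Delta t^4),$$ where $$C_k=c_k,\qquad D_k=\sum_{j=1}^{k-1}b_{kj}\big(D_j+(c_k-c_j)c_j\big),$$ $$B_k=\Big(1-\sum_{j=1}^{k-1}b_{kj}\Big)c_k^2+\sum_{j=1}^{k-1}b_{kj}\big(B_j+(c_k-c_j)^2\big),$$ $$G_k=\sum_{j=1}^{k-1}b_{kj}\big(G_j+\tfrac12(c_k-c_j)c_j^2\big),\qquad H_k=\sum_{j=1}^{k-1}b_{kj}\big(H_j+(c_k-c_j)D_j\big),$$ $$B_k^{*}=\sum_{j=1}^{k-1}b_{kj}\big(B_j^{*}+(c_k-c_j)B_j\big),\qquad B_k^{**}=\sum_{j=1}^{k-1}b_{kj}\big(B_j^{**}+(c_k-c_j)^2c_j\big),$$ $$B_k^{***}=\Big(1-\sum_{j=1}^{k-1}b_{kj}\Big)c_k^3+\sum_{j=1}^{k-1}b_{kj}\big(B_j^{***}+(c_k-c_j)^3\big).$$ Third order accuracy of the U scheme means that its order conditions up to order three hold: $C_s=1$ (first order); $D_s=\frac12$, $B_s=0$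 (second order); $G_s=H_s=\frac16$, $B_s^{*}=B_s^{**}=B_s^{***}=0$ (third order). *)

theory Defs
  imports "Jordan_Normal_Form.Determinant"
begin

(* Stages are numbered 1, ..., s as in the Butcher tableau, whereas matrix and vector indices
   start at 0; rk_a A k j is the tableau entry a_{kj}.  All coefficients below are meaningful
   only for stage numbers 1 \<le> k \<le> dim_row A (and 1 \<le> j < k for rk_b). *)

definition rk_a :: "real mat \<Rightarrow> nat \<Rightarrow> nat \<Rightarrow> real" where
  "rk_a A k j = A $$ (k - 1, j - 1)"

definition lower_triangular :: "real mat \<Rightarrow> bool" where
  "lower_triangular A \<longleftrightarrow> (\<forall>i < dim_row A. \<forall>j < dim_col A. i < j \<longrightarrow> A $$ (i, j) = 0)"

(* w is the weight vector: the update of the method is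
   f^{n+1} = f^n + \<Delta>t (\<Sum>j. w_j Q(f^{(j)})). *)

definition stiffly_accurate :: "real mat \<Rightarrow> real vec \<Rightarrow> bool" where
  "stiffly_accurate A w \<longleftrightarrow> row A (dim_row A - 1) = w"

definition rk_c :: "real mat \<Rightarrow> nat \<Rightarrow> real" where
  "rk_c A k = (\<Sum>j\<in>{1..k}. rk_a A k j)"

function rk_b :: "real mat \<Rightarrow> nat \<Rightarrow> nat \<Rightarrow> real" where
  "rk_b A k j = rk_a A k j / rk_a A j j - (\<Sum>l\<in>{j<..<k}. rk_a A k l * rk_b A l j / rk_a A l l)"
  by auto
termination by (relation "measure (\<lambda>(A, k, j). k)") auto

declare rk_b.simps [simp del]

(* Taylor coefficients of the f scheme:
     f_d: Q'Q,   f_g: Q''(Q,Q),   f_h: Q'Q'Q. *)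

function f_d :: "real mat \<Rightarrow> nat \<Rightarrow> real" where
  "f_d A k = (\<Sum>j\<in>{1..<k}. rk_b A k j * f_d A j) + rk_a A k k * rk_c A k"
  by auto
termination by (relation "measure (\<lambda>(A, k). k)") auto

declare f_d.simps [simp del]

function f_g :: "real mat \<Rightarrow> nat \<Rightarrow> real" where
  "f_g A k = (\<Sum>j\<in>{1..<k}. rk_b A k j * f_g A j) + 1 / 2 * rk_a A k k * (rk_c A k)^2"
  by auto
termination by (relation "measure (\<lambda>(A, k). k)") auto

declare f_g.simps [simp del]

function f_h :: "real mat \<Rightarrow> nat \<Rightarrow> real" where
  "f_h A k = (\<Sum>j\<in>{1..<k}. rk_b A k j * f_h A j) + rk_a A k k * f_d A k"
  by auto
termination by (relation "measure (\<lambda>(A, k). k)") auto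

declare f_h.simps [simp del]

(* Taylor coefficients of the U scheme:
     U_C: T,   U_D: T'T,   U_B: \<B> = (1/2) <v^2 d_xx(M_U[U]) phi>,
     U_G: T''(T,T),   U_H: T'T'T,
     U_Bs (B^{*}): T'\<B>,   U_Bss (B^{**}): \<B>'T,
     U_Bsss (B^{***}): -(1/6) <v^3 d_xxx(M_U[U]) phi>. *)

definition U_C :: "real mat \<Rightarrow> nat \<Rightarrow> real" where
  "U_C A k = rk_c A k"

function U_D :: "real mat \<Rightarrow> nat \<Rightarrow> real" where
  "U_D A k = (\<Sum>j\<in>{1..<k}. rk_b A k j * (U_D A j + (rk_c A k - rk_c A j) * rk_c A j))"
  by auto
termination by (relation "measure (\<lambda>(A, k). k)") auto

declare U_D.simps [simp del]

function U_B :: "real mat \<Rightarrow> nat \<Rightarrow> real" where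
  "U_B A k = (1 - (\<Sum>j\<in>{1..<k}. rk_b A k j)) * (rk_c A k)^2
     + (\<Sum>j\<in>{1..<k}. rk_b A k j * (U_B A j + (rk_c A k - rk_c A j)^2))"
  by auto
termination by (relation "measure (\<lambda>(A, k). k)") auto

declare U_B.simps [simp del]

function U_G :: "real mat \<Rightarrow> nat \<Rightarrow> real" where
  "U_G A k = (\<Sum>j\<in>{1..<k}. rk_b A k j * (U_G A j + 1 / 2 * (rk_c A k - rk_c A j) * (rk_c A j)^2))"
  by auto
termination by (relation "measure (\<lambda>(A, k). k)") auto

declare U_G.simps [simp del]

function U_H :: "real mat \<Rightarrow> nat \<Rightarrow> real" where
  "U_H A k = (\<Sum>j\<in>{1..<k}. rk_b A k j * (U_H A j + (rk_c A k - rk_c A j) * U_D A j))"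
  by auto
termination by (relation "measure (\<lambda>(A, k). k)") auto

declare U_H.simps [simp del]

function U_Bs :: "real mat \<Rightarrow> nat \<Rightarrow> real" where
  "U_Bs A k = (\<Sum>j\<in>{1..<k}. rk_b A k j * (U_Bs A j + (rk_c A k - rk_c A j) * U_B A j))"
  by auto
termination by (relation "measure (\<lambda>(A, k). k)") auto

declare U_Bs.simps [simp del]

function U_Bss :: "real mat \<Rightarrow> nat \<Rightarrow> real" where
  "U_Bss A k = (\<Sum>j\<in>{1..<k}. rk_b A k j * (U_Bss A j + (rk_c A k - rk_c A j)^2 * rk_c A j))"
  by auto
termination by (relation "measure (\<lambda>(A, k). k)") auto

declare U_Bss.simps [simp del]

function U_Bsss :: "real mat \<Rightarrow> nat \<Rightarrow> real" where
  "U_Bsss A k = (1 - (\<Sum>j\<in>{1..<k}. rk_b A k j)) * (rk_c A k)^3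
     + (\<Sum>j\<in>{1..<k}. rk_b A k j * (U_Bsss A j + (rk_c A k - rk_c A j)^3))"
  by auto
termination by (relation "measure (\<lambda>(A, k). k)") auto

declare U_Bsss.simps [simp del]

end

theory Submission
  imports Defs
begin

text \<open>Write (L x)_k = x_k - (\<Sum>j<k. b_{kj} x_j) for the unit lower triangular operator inverted
  by all the recursions, and a for the diagonal of A. Then L c = a, L d = a c and
  L g = a c^2 / 2, while 2 (L G)_k = (L c^3)_k - c_k (L c^2)_k. Rewriting the right hand side of
  each recursion of the U scheme by means of these identities and inverting L gives, at every stage,
  D = c^2 - d, B = 2 d - c^2, H = 2 G + 2 g - c d, B* = 2 c d - 4 g - 2 G, B** = c^3 - 2 g - 4 G
  and B*** = 6 g + 6 G - 2 c^3, which at the last stage are the asserted values.\<close>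

text \<open>\<open>rk_b\<close> divides by diagonal entries, and HOL evaluates x / 0 to 0, so the
  cancellations below need every diagonal entry to be nonzero.\<close>

lemma lower_triangular_diag_nonzero:
  fixes A :: "real mat"
  assumes A: "A \<in> carrier_mat n n" and "lower_triangular A" and "invertible_mat A" and i: "i < n"
  shows "A $$ (i, i) \<noteq> 0"
proof -
  have "det A = prod_list (diag_mat A)"
    using assms(2) A by (intro det_lower_triangular[OF _ A]) (auto simp: lower_triangular_def)
  moreover have "det A \<noteq> 0"
  proof -
    from assms(3) obtain B where AB: "A * B = 1\<^sub>m (dim_row A)" and BA: "B * A = 1\<^sub>m (dim_row B)"
      by (auto simp: invertible_mat_def inverts_mat_def)
    \<comment> \<open>\<open>invertible_mat\<close> does not fix the size of the inverse; comparing
      column counts in both product identities does.\<close>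
    have "B \<in> carrier_mat n n"
      using arg_cong[OF AB, of dim_col] arg_cong[OF BA, of dim_col] A by auto
    then have "det A * det B = 1"
      using det_mult[OF A, of B] AB A by simp
    then show ?thesis by auto
  qed
  ultimately have "0 \<notin> set (diag_mat A)"
    by (simp add: prod_list_zero_iff)
  then show ?thesis
    using i A by (force simp: diag_mat_def)
qed

context
  fixes A :: "real mat" and s :: nat
  assumes diag: "\<And>j. 1 \<le> j \<Longrightarrow> j \<le> s \<Longrightarrow> rk_a A j j \<noteq> 0"
begin

text \<open>This is L c = a. The recursion for b says that (\<Sum>l<k. a_{kl} / a_{ll} * (L x)_l) =
  (\<Sum>j<k. b_{kj} x_j) for every x; take x = c and use (L c)_l = a_{ll} at the earlier
  stages.\<close>

lemma rk_c_rec: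
  assumes "1 \<le> k" and "k \<le> s"
  shows "rk_c A k = (\<Sum>j\<in>{1..<k}. rk_b A k j * rk_c A j) + rk_a A k k"
  using assms
proof (induction k rule: less_induct)
  case (less k)
  have "(\<Sum>l\<in>{1..<k}. rk_a A k l)
      = (\<Sum>l\<in>{1..<k}. rk_a A k l / rk_a A l l * (rk_c A l - (\<Sum>j\<in>{1..<l}. rk_b A l j * rk_c A j)))"
  proof (rule sum.cong[OF refl])
    fix l assume l: "l \<in> {1..<k}"
    then have "rk_c A l - (\<Sum>j\<in>{1..<l}. rk_b A l j * rk_c A j) = rk_a A l l"
      using less.IH[of l] less.prems by simp
    then show "rk_a A k l
        = rk_a A k l / rk_a A l l * (rk_c A l - (\<Sum>j\<in>{1..<l}. rk_b A l j * rk_c A j))"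
      using diag[of l] l less.prems by simp
  qed
  also have "\<dots> = (\<Sum>l\<in>{1..<k}. rk_a A k l / rk_a A l l * rk_c A l)
      - (\<Sum>l\<in>{1..<k}. \<Sum>j\<in>{1..<l}. rk_a A k l * rk_b A l j / rk_a A l l * rk_c A j)"
    by (simp add: right_diff_distrib sum_subtractf sum_distrib_left mult_ac)
  \<comment> \<open>Both sides run over the pairs 1 \<le> j < l < k.\<close>
  also have "(\<Sum>l\<in>{1..<k}. \<Sum>j\<in>{1..<l}. rk_a A k l * rk_b A l j / rk_a A l l * rk_c A j)
      = (\<Sum>j\<in>{1..<k}. \<Sum>l\<in>{j<..<k}. rk_a A k l * rk_b A l j / rk_a A l l * rk_c A j)"
    unfolding sum.Sigma[OF finite_atLeastLessThan ballI[OF finite_atLeastLessThan]]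
      sum.Sigma[OF finite_atLeastLessThan ballI[OF finite_greaterThanLessThan]]
    by (rule sum.reindex_bij_witness[of _ prod.swap prod.swap]) auto
  also have "(\<Sum>l\<in>{1..<k}. rk_a A k l / rk_a A l l * rk_c A l) - \<dots>
      = (\<Sum>j\<in>{1..<k}. rk_b A k j * rk_c A j)"
    \<comment> \<open>Only \<open>rk_b A k j\<close> on the right is unfolded; its defining sum is
      the inner sum just obtained.\<close>
    by (subst (2) rk_b.simps) (simp add: left_diff_distrib sum_subtractf sum_distrib_right)
  finally have "(\<Sum>l\<in>{1..<k}. rk_a A k l) = (\<Sum>j\<in>{1..<k}. rk_b A k j * rk_c A j)" .
  moreover have "rk_c A k = (\<Sum>l\<in>{1..<k}. rk_a A k l) + rk_a A k k"
    using less.prems(1) by (simp add: rk_c_def sum.last_plus)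
  ultimately show ?case by simp
qed

text \<open>Since (\<Sum>j<k. b_{kj} c_j) = c_k - a_{kk}, the inhomogeneous term is (L c^2)_k -
  a_{kk} c_k, which is L applied to c^2 - d.\<close>

lemma U_D_eq:
  assumes "1 \<le> k" and "k \<le> s"
  shows "U_D A k = rk_c A k ^ 2 - f_d A k"
  using assms
proof (induction k rule: less_induct)
  case (less k)
  have a: "rk_a A k k = rk_c A k - (\<Sum>j\<in>{1..<k}. rk_b A k j * rk_c A j)"
    using rk_c_rec less.prems by simp
  have "U_D A k = (\<Sum>j\<in>{1..<k}. rk_b A k j * (rk_c A j ^ 2 - f_d A j + (rk_c A k - rk_c A j) * rk_c A j))"
    unfolding U_D.simps[of A k] using less.IH less.prems by (simp)
  also have "\<dots> = rk_c A k ^ 2 - f_d A k"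
    \<comment> \<open>Unfolding at stage k only keeps the coefficients of earlier stages atomic;
      what remains is linear in the sums over j.\<close>
    unfolding f_d.simps[of A k] a
    by (simp add: algebra_simps sum.distrib sum_subtractf sum_distrib_left
        power2_eq_square power3_eq_cube sum_negf)
  finally show ?case .
qed

text \<open>The weight 1 - (\<Sum>j<k. b_{kj}) cancels the bare sum of the b_{kj} from the expanded
  square, leaving 2 a_{kk} c_k - (L c^2)_k.\<close>

lemma U_B_eq:
  assumes "1 \<le> k" and "k \<le> s"
  shows "U_B A k = 2 * f_d A k - rk_c A k ^ 2"
  using assms
proof (induction k rule: less_induct)
  case (less k)
  have a: "rk_a A k k = rk_c A k - (\<Sum>j\<in>{1..<k}. rk_b A k j * rk_c A j)"
    using rk_c_rec less.prems by simp
  have "U_B A k = (1 - (\<Sum>j\<in>{1..<k}. rk_b A k j)) * rk_c A k ^ 2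
      + (\<Sum>j\<in>{1..<k}. rk_b A k j * (2 * f_d A j - rk_c A j ^ 2 + (rk_c A k - rk_c A j)^2))"
    unfolding U_B.simps[of A k] using less.IH less.prems by (simp)
  also have "\<dots> = 2 * f_d A k - rk_c A k ^ 2"
    unfolding f_d.simps[of A k] a
    by (simp add: algebra_simps sum.distrib sum_subtractf sum_distrib_left
        power2_eq_square power3_eq_cube sum_negf)
  finally show ?case .
qed

text \<open>With D = c^2 - d, the c^2 part contributes 2 (L G)_k. The d part contributes a_{kk}
  c_k^2 - (L (c d))_k, where a_{kk} c_k^2 = 2 (L g)_k.\<close>

lemma U_H_eq:
  assumes "1 \<le> k" and "k \<le> s"
  shows "U_H A k = 2 * U_G A k + 2 * f_g A k - rk_c A k * f_d A k"
  using assms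
proof (induction k rule: less_induct)
  case (less k)
  have a: "rk_a A k k = rk_c A k - (\<Sum>j\<in>{1..<k}. rk_b A k j * rk_c A j)"
    using rk_c_rec less.prems by simp
  have "U_H A k = (\<Sum>j\<in>{1..<k}. rk_b A k j * (2 * U_G A j + 2 * f_g A j - rk_c A j * f_d A j + (rk_c A k - rk_c A j) * (rk_c A j ^ 2 - f_d A j)))"
    unfolding U_H.simps[of A k] using less.IH less.prems by (simp add: U_D_eq)
  also have "\<dots> = 2 * U_G A k + 2 * f_g A k - rk_c A k * f_d A k"
    unfolding f_d.simps[of A k] f_g.simps[of A k] U_G.simps[of A k] a
    by (simp add: algebra_simps sum.distrib sum_subtractf sum_distrib_left
        power2_eq_square power3_eq_cube sum_negf)
  finally show ?case .
qed

text \<open>The same splitting as for H, now with B = 2 d - c^2: the d part is doubled and both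
  signs flip.\<close>

lemma U_Bs_eq:
  assumes "1 \<le> k" and "k \<le> s"
  shows "U_Bs A k = 2 * rk_c A k * f_d A k - 4 * f_g A k - 2 * U_G A k"
  using assms
proof (induction k rule: less_induct)
  case (less k)
  have a: "rk_a A k k = rk_c A k - (\<Sum>j\<in>{1..<k}. rk_b A k j * rk_c A j)"
    using rk_c_rec less.prems by simp
  have "U_Bs A k = (\<Sum>j\<in>{1..<k}. rk_b A k j * (2 * rk_c A j * f_d A j - 4 * f_g A j - 2 * U_G A j + (rk_c A k - rk_c A j) * (2 * f_d A j - rk_c A j ^ 2)))"
    unfolding U_Bs.simps[of A k] using less.IH less.prems by (simp add: U_B_eq)
  also have "\<dots> = 2 * rk_c A k * f_d A k - 4 * f_g A k - 2 * U_G A k"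
    unfolding f_d.simps[of A k] f_g.simps[of A k] U_G.simps[of A k] a
    by (simp add: algebra_simps sum.distrib sum_subtractf sum_distrib_left
        power2_eq_square power3_eq_cube sum_negf)
  finally show ?case .
qed

text \<open>In the expanded square, c_k^2 (\<Sum>j<k. b_{kj} c_j) = c_k^3 - 2 (L g)_k, and the mixed
  term is eliminated through L G.\<close>

lemma U_Bss_eq:
  assumes "1 \<le> k" and "k \<le> s"
  shows "U_Bss A k = rk_c A k ^ 3 - 2 * f_g A k - 4 * U_G A k"
  using assms
proof (induction k rule: less_induct)
  case (less k)
  have a: "rk_a A k k = rk_c A k - (\<Sum>j\<in>{1..<k}. rk_b A k j * rk_c A j)"
    using rk_c_rec less.prems by simp
  have "U_Bss A k = (\<Sum>j\<in>{1..<k}. rk_b A k j * (rk_c A j ^ 3 - 2 * f_g A j - 4 * U_G A j + (rk_c A k - rk_c A j)^2 * rk_c A j))"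
    unfolding U_Bss.simps[of A k] using less.IH less.prems by (simp)
  also have "\<dots> = rk_c A k ^ 3 - 2 * f_g A k - 4 * U_G A k"
    unfolding f_g.simps[of A k] U_G.simps[of A k] a
    by (simp add: algebra_simps sum.distrib sum_subtractf sum_distrib_left
        power2_eq_square power3_eq_cube sum_negf)
  finally show ?case .
qed

text \<open>As for B, the bare sum of the b_{kj} cancels; the two mixed terms of the cube yield 6 (L
  g)_k and 6 (L G)_k, up to multiples of c_k^3 and of the b-weighted sum of c_j^3.\<close>

lemma U_Bsss_eq:
  assumes "1 \<le> k" and "k \<le> s"
  shows "U_Bsss A k = 6 * f_g A k + 6 * U_G A k - 2 * rk_c A k ^ 3"
  using assms
proof (induction k rule: less_induct)
  case (less k)
  have a: "rk_a A k k = rk_c A k - (\<Sum>j\<in>{1..<k}. rk_b A k j * rk_c A j)"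
    using rk_c_rec less.prems by simp
  have "U_Bsss A k = (1 - (\<Sum>j\<in>{1..<k}. rk_b A k j)) * rk_c A k ^ 3
      + (\<Sum>j\<in>{1..<k}. rk_b A k j * (6 * f_g A j + 6 * U_G A j - 2 * rk_c A j ^ 3 + (rk_c A k - rk_c A j)^3))"
    unfolding U_Bsss.simps[of A k] using less.IH less.prems by (simp)
  also have "\<dots> = 6 * f_g A k + 6 * U_G A k - 2 * rk_c A k ^ 3"
    unfolding f_g.simps[of A k] U_G.simps[of A k] a
    by (simp add: algebra_simps sum.distrib sum_subtractf sum_distrib_left
        power2_eq_square power3_eq_cube sum_negf)
  finally show ?case .
qed

end

theorem theorem3p5:
  fixes A :: "real mat" and w :: "real vec" and s :: nat
  assumes "s \<ge> 1" and "A \<in> carrier_mat s s"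
    and "lower_triangular A" and "invertible_mat A"
    and "stiffly_accurate A w"
    and "rk_c A s = 1" and "f_d A s = 1 / 2" and "f_g A s = 1 / 6" and "f_h A s = 1 / 6"
    and "U_G A s = 1 / 6"
  shows "U_C A s = 1 \<and> U_D A s = 1 / 2 \<and> U_B A s = 0
    \<and> U_G A s = 1 / 6 \<and> U_H A s = 1 / 6
    \<and> U_Bs A s = 0 \<and> U_Bss A s = 0 \<and> U_Bsss A s = 0"
proof -
  have diag: "rk_a A j j \<noteq> 0" if "1 \<le> j" "j \<le> s" for j
    \<comment> \<open>Stage j is matrix index j - 1.\<close>
    using lower_triangular_diag_nonzero[OF assms(2-4), of "j - 1"] that by (simp add: rk_a_def)
  show ?thesis
    using assms(1,6-10) U_D_eq[OF diag, of s] U_B_eq[OF diag, of s] U_H_eq[OF diag, of s]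
      U_Bs_eq[OF diag, of s] U_Bss_eq[OF diag, of s] U_Bsss_eq[OF diag, of s]
    by (simp add: U_C_def)
qed

end
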